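(* Let $(M,g,q)$ be a $3$-dimensional Riemannian manifold with circulant structure $q$ as in the context, let $f$ be the associated metric, let $p\in M$, and let $\{u,qu,q^{2}u\}$ be a $g$-orthonormal $q$-basis of $T_pM$. Let $p_{xyz}$ be the coordinate system on $T_pM$ with origin $p$ (the zero vector) whose axes $p_x,p_y,p_z$ are directed along $u,qu,q^2u$, so that the point $(x,y,z)$ has radius vector $v=xu+y\,qu+z\,q^2u$. Let $p_{x'y'z'}$ be the coordinate system obtained from $p_{xyz}$ by the rotation $$x=\tfrac{1}{\sqrt2}x'-\tfrac{1}{\sqrt6}y'+\tfrac{1}{\sqrt3}z',\qquad y=\tfrac{\sqrt2}{\sqrt3}y'+\tfrac{1}{\sqrt3}z',\qquad z=-\tfrac{1}{\sqrt2}x'-\tfrac{1}{\sqrt6}y'+\tfrac{1}{\sqrt3}z'.$$ Let $r^2$ denote a real constant (possibly zero or negative) and let $s$ be the set of points of $T_pM$ whose radius vector $v$ satisfies $f(v,v)=r^2$. Then the equation of $s$ with respect to $p_{x'y'z'}$ is $$x'^2+y'^2-2z'^2=-r^2.$$ Moreover: (i) if $r^2=0$, then $s$ is the circular double cone $s_0:\ x'^2+y'^2-2z'^2=0$; (ii) if $r^2>0$, then $s$ is the circular hyperboloid of two sheets $s_1:\ x'^2+y'^2-2z'^2=-a^2$, where $a^2=r^2>0$; (iii) if $r^2<0$, then $s$ is the circular hyperboloid of one sheet $s_2:\ x'^2+y'^2-2z'^2=a^2$, where $a^2=-r^2>0$.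
   Context: $(M,g,q)$ denotes a $3$-dimensional differentiable manifold $M$ with a $(1,1)$-tensor field $q$ whose components in a local coordinate system form the circulant matrix $\begin{pmatrix}0&1&0\\0&0&1\\1&0&0\end{pmatrix}$ (so $q^3=\mathrm{id}$), and a positive definite metric $g$ with $g(qu,qv)=g(u,v)$ for all $u,v$. The associated metric is $f(u,v)=g(u,qv)+g(qu,v)$; it is indefinite. A $q$-basis of $T_pM$ is a basis of the form $\{u,qu,q^2u\}$; orthonormal means orthonormal with respect to $g$. The set $s$ is called the sphere of radius $r$ centered at $p$ with respect to $f$. *)

theory Defs
  imports "HOL-Analysis.Analysis" "HOL-Library.Function_Algebras"
begin

text \<open>\<open>C_on k S f\<close>: \<open>f\<close> is of class C^k on the open set \<open>S\<close>.\<close>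

primrec C_on ::
  "nat \<Rightarrow> 'a::real_normed_vector set \<Rightarrow> ('a \<Rightarrow> 'b::real_normed_vector) \<Rightarrow> bool"
where
  "C_on 0 S f \<longleftrightarrow> continuous_on S f"
| "C_on (Suc k) S f \<longleftrightarrow>
     f differentiable_on S \<and> (\<forall>h. C_on k S (\<lambda>x. frechet_derivative f (at x) h))"

definition smooth_on ::
  "'a::real_normed_vector set \<Rightarrow> ('a \<Rightarrow> 'b::real_normed_vector) \<Rightarrow> bool" where
  "smooth_on S f \<longleftrightarrow> (\<forall>k. C_on k S f)"

text \<open>A chart is a domain with a coordinate map; the values of the coordinate map outside
  the domain are irrelevant.\<close>

type_synonym 'm chart = "'m set \<times> ('m \<Rightarrow> real^3)"

abbreviation dom_of :: "'m chart \<Rightarrow> 'm set" where "dom_of \<equiv> fst"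
abbreviation coord_of :: "'m chart \<Rightarrow> 'm \<Rightarrow> real^3" where "coord_of \<equiv> snd"

definition chart_inv :: "'m chart \<Rightarrow> real^3 \<Rightarrow> 'm" where
  "chart_inv c = inv_into (dom_of c) (coord_of c)"

definition is_chart :: "'m topology \<Rightarrow> 'm chart \<Rightarrow> bool" where
  "is_chart M c \<longleftrightarrow>
     openin M (dom_of c) \<and> open (coord_of c ` dom_of c) \<and>
     homeomorphic_map (subtopology M (dom_of c)) (top_of_set (coord_of c ` dom_of c)) (coord_of c)"

definition transition :: "'m chart \<Rightarrow> 'm chart \<Rightarrow> real^3 \<Rightarrow> real^3" where
  "transition c c' = coord_of c' \<circ> chart_inv c"

definition compatible :: "'m chart \<Rightarrow> 'm chart \<Rightarrow> bool" where
  "compatible c c' \<longleftrightarrow>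
     smooth_on (coord_of c ` (dom_of c \<inter> dom_of c')) (transition c c') \<and>
     smooth_on (coord_of c' ` (dom_of c \<inter> dom_of c')) (transition c' c)"

text \<open>\<open>A\<close> is the maximal atlas.\<close>

definition smooth_3_manifold :: "'m topology \<Rightarrow> 'm chart set \<Rightarrow> bool" where
  "smooth_3_manifold M A \<longleftrightarrow>
     Hausdorff_space M \<and> second_countable M \<and>
     (\<forall>c\<in>A. is_chart M c) \<and>
     (\<Union>c\<in>A. dom_of c) = topspace M \<and>
     (\<forall>c\<in>A. \<forall>c'\<in>A. compatible c c') \<and>
     (\<forall>c. is_chart M c \<longrightarrow> (\<forall>c'\<in>A. compatible c c') \<longrightarrow> c \<in> A)"

text \<open>Pointwise vector space structure; it makes each tangent space below a linear subspace
  of a function type, so that \<open>span\<close> and \<open>independent\<close> apply to it.\<close>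

instantiation "fun" :: (type, real_vector) real_vector
begin

definition scaleR_fun :: "real \<Rightarrow> ('a \<Rightarrow> 'b) \<Rightarrow> 'a \<Rightarrow> 'b" where
  "scaleR_fun a F = (\<lambda>x. a *\<^sub>R F x)"

instance
  by standard (auto simp: scaleR_fun_def fun_eq_iff algebra_simps)

end

text \<open>A tangent vector at \<open>p\<close> is the classical contravariant vector: it assigns to each chart
  around \<open>p\<close> a component triple, and the triples are related by the Jacobians of the
  transition maps. Charts not around \<open>p\<close> get the value 0, so that tangent vectors are
  equal iff their components are.\<close>

type_synonym 'm tvec = "'m chart \<Rightarrow> real^3"

definition tangent_space :: "'m chart set \<Rightarrow> 'm \<Rightarrow> 'm tvec set" where
  "tangent_space A p =
     {v. (\<forall>c\<in>A. \<forall>c'\<in>A. p \<in> dom_of c \<longrightarrow> p \<in> dom_of c' \<longrightarrow>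
            v c' = frechet_derivative (transition c c') (at (coord_of c p)) (v c)) \<and>
         (\<forall>c. \<not> (c \<in> A \<and> p \<in> dom_of c) \<longrightarrow> v c = 0)}"

text \<open>The coordinate vector \<open>\<partial>/\<partial>x\<^sub>i\<close> of the chart \<open>c\<close> at \<open>p\<close>.\<close>

definition coord_vector :: "'m chart set \<Rightarrow> 'm chart \<Rightarrow> 'm \<Rightarrow> 3 \<Rightarrow> 'm tvec" where
  "coord_vector A c p i =
     (\<lambda>c'. if c' \<in> A \<and> p \<in> dom_of c'
           then frechet_derivative (transition c c') (at (coord_of c p)) (axis i 1)
           else 0)"

definition linear_on ::
  "'a::real_vector set \<Rightarrow> ('a \<Rightarrow> 'b::real_vector) \<Rightarrow> bool" where
  "linear_on T F \<longleftrightarrow>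
     (\<forall>v\<in>T. \<forall>w\<in>T. \<forall>a b. F (a *\<^sub>R v + b *\<^sub>R w) = a *\<^sub>R F v + b *\<^sub>R F w)"

definition smooth_components ::
  "'m chart set \<Rightarrow> ('m chart \<Rightarrow> 'm \<Rightarrow> real^3^3) \<Rightarrow> bool" where
  "smooth_components A K \<longleftrightarrow>
     (\<forall>c\<in>A. smooth_on (coord_of c ` dom_of c) (K c \<circ> chart_inv c))"

text \<open>Column \<open>j\<close> of the component matrix of a (1,1)-tensor field holds the components of
  the image of the \<open>j\<close>-th coordinate vector.\<close>

definition tensor11_components ::
  "'m chart set \<Rightarrow> ('m \<Rightarrow> 'm tvec \<Rightarrow> 'm tvec) \<Rightarrow> 'm chart \<Rightarrow> 'm \<Rightarrow> real^3^3" where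
  "tensor11_components A q c p = (\<chi> i j. q p (coord_vector A c p j) c $ i)"

definition tensor02_components ::
  "'m chart set \<Rightarrow> ('m \<Rightarrow> 'm tvec \<Rightarrow> 'm tvec \<Rightarrow> real) \<Rightarrow> 'm chart \<Rightarrow> 'm \<Rightarrow> real^3^3" where
  "tensor02_components A g c p = (\<chi> i j. g p (coord_vector A c p i) (coord_vector A c p j))"

definition tensor11_field ::
  "'m topology \<Rightarrow> 'm chart set \<Rightarrow> ('m \<Rightarrow> 'm tvec \<Rightarrow> 'm tvec) \<Rightarrow> bool" where
  "tensor11_field M A q \<longleftrightarrow>
     (\<forall>p\<in>topspace M. q p ` tangent_space A p \<subseteq> tangent_space A p \<and>
                     linear_on (tangent_space A p) (q p)) \<and>
     smooth_components A (tensor11_components A q)"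

definition riemannian_metric ::
  "'m topology \<Rightarrow> 'm chart set \<Rightarrow> ('m \<Rightarrow> 'm tvec \<Rightarrow> 'm tvec \<Rightarrow> real) \<Rightarrow> bool" where
  "riemannian_metric M A g \<longleftrightarrow>
     (\<forall>p\<in>topspace M.
        (\<forall>v\<in>tangent_space A p. linear_on (tangent_space A p) (g p v)) \<and>
        (\<forall>v\<in>tangent_space A p. \<forall>w\<in>tangent_space A p. g p v w = g p w v) \<and>
        (\<forall>v\<in>tangent_space A p. v \<noteq> 0 \<longrightarrow> g p v v > 0)) \<and>
     smooth_components A (tensor02_components A g)"

definition circulant_matrix :: "real^3^3" where
  "circulant_matrix = vector [vector [0, 1, 0], vector [0, 0, 1], vector [1, 0, 0]]"

definition circulant_structure ::
  "'m topology \<Rightarrow> 'm chart set \<Rightarrow> ('m \<Rightarrow> 'm tvec \<Rightarrow> 'm tvec) \<Rightarrow> bool" where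
  "circulant_structure M A q \<longleftrightarrow>
     tensor11_field M A q \<and>
     (\<forall>p\<in>topspace M. \<exists>c\<in>A. p \<in> dom_of c \<and>
        (\<forall>p'\<in>dom_of c. tensor11_components A q c p' = circulant_matrix))"

definition circulant_riemannian_manifold ::
  "'m topology \<Rightarrow> 'm chart set \<Rightarrow> ('m \<Rightarrow> 'm tvec \<Rightarrow> 'm tvec \<Rightarrow> real) \<Rightarrow>
   ('m \<Rightarrow> 'm tvec \<Rightarrow> 'm tvec) \<Rightarrow> bool" where
  "circulant_riemannian_manifold M A g q \<longleftrightarrow>
     smooth_3_manifold M A \<and> circulant_structure M A q \<and> riemannian_metric M A g \<and>
     (\<forall>p\<in>topspace M. \<forall>v\<in>tangent_space A p. \<forall>w\<in>tangent_space A p.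
        g p (q p v) (q p w) = g p v w)"

definition associated_metric ::
  "('m \<Rightarrow> 'm tvec \<Rightarrow> 'm tvec \<Rightarrow> real) \<Rightarrow> ('m \<Rightarrow> 'm tvec \<Rightarrow> 'm tvec) \<Rightarrow>
   'm \<Rightarrow> 'm tvec \<Rightarrow> 'm tvec \<Rightarrow> real" where
  "associated_metric g q p v w = g p v (q p w) + g p (q p v) w"

text \<open>The last argument is the squared radius, an arbitrary real number.\<close>

definition f_sphere ::
  "'m chart set \<Rightarrow> ('m \<Rightarrow> 'm tvec \<Rightarrow> 'm tvec \<Rightarrow> real) \<Rightarrow> ('m \<Rightarrow> 'm tvec \<Rightarrow> 'm tvec) \<Rightarrow>
   'm \<Rightarrow> real \<Rightarrow> 'm tvec set" where
  "f_sphere A g q p r2 = {v \<in> tangent_space A p. associated_metric g q p v v = r2}"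

definition is_basis3 :: "'a::real_vector set \<Rightarrow> 'a \<Rightarrow> 'a \<Rightarrow> 'a \<Rightarrow> bool" where
  "is_basis3 T e1 e2 e3 \<longleftrightarrow>
     distinct [e1, e2, e3] \<and> independent {e1, e2, e3} \<and> span {e1, e2, e3} = T"

definition orthonormal3 :: "('a \<Rightarrow> 'a \<Rightarrow> real) \<Rightarrow> 'a \<Rightarrow> 'a \<Rightarrow> 'a \<Rightarrow> bool" where
  "orthonormal3 G e1 e2 e3 \<longleftrightarrow>
     G e1 e1 = 1 \<and> G e2 e2 = 1 \<and> G e3 e3 = 1 \<and>
     G e1 e2 = 0 \<and> G e1 e3 = 0 \<and> G e2 e3 = 0"

text \<open>A coordinate system is given by the map sending a coordinate triple to the point of \<open>T\<close>
  with these coordinates; it is Cartesian with respect to the inner product \<open>G\<close> on \<open>T\<close>.\<close>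

definition cartesian_system ::
  "'a::real_vector set \<Rightarrow> ('a \<Rightarrow> 'a \<Rightarrow> real) \<Rightarrow> (real \<Rightarrow> real \<Rightarrow> real \<Rightarrow> 'a) \<Rightarrow> bool" where
  "cartesian_system T G P \<longleftrightarrow>
     (\<exists>b e1 e2 e3. b \<in> T \<and> is_basis3 T e1 e2 e3 \<and> orthonormal3 G e1 e2 e3 \<and>
        P = (\<lambda>x y z. b + x *\<^sub>R e1 + y *\<^sub>R e2 + z *\<^sub>R e3))"

text \<open>Quadrics of revolution in the Euclidean space \<open>(T, G)\<close>, by their canonical equations.\<close>

definition circular_double_cone ::
  "'a::real_vector set \<Rightarrow> ('a \<Rightarrow> 'a \<Rightarrow> real) \<Rightarrow> 'a set \<Rightarrow> bool" where
  "circular_double_cone T G S \<longleftrightarrow>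
     (\<exists>P \<alpha> \<gamma>. cartesian_system T G P \<and> \<alpha> > 0 \<and> \<gamma> > 0 \<and>
        S = {P x y z | x y z. x\<^sup>2 / \<alpha>\<^sup>2 + y\<^sup>2 / \<alpha>\<^sup>2 - z\<^sup>2 / \<gamma>\<^sup>2 = 0})"

definition circular_hyperboloid_two_sheets ::
  "'a::real_vector set \<Rightarrow> ('a \<Rightarrow> 'a \<Rightarrow> real) \<Rightarrow> 'a set \<Rightarrow> bool" where
  "circular_hyperboloid_two_sheets T G S \<longleftrightarrow>
     (\<exists>P \<alpha> \<gamma>. cartesian_system T G P \<and> \<alpha> > 0 \<and> \<gamma> > 0 \<and>
        S = {P x y z | x y z. x\<^sup>2 / \<alpha>\<^sup>2 + y\<^sup>2 / \<alpha>\<^sup>2 - z\<^sup>2 / \<gamma>\<^sup>2 = -1})"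

definition circular_hyperboloid_one_sheet ::
  "'a::real_vector set \<Rightarrow> ('a \<Rightarrow> 'a \<Rightarrow> real) \<Rightarrow> 'a set \<Rightarrow> bool" where
  "circular_hyperboloid_one_sheet T G S \<longleftrightarrow>
     (\<exists>P \<alpha> \<gamma>. cartesian_system T G P \<and> \<alpha> > 0 \<and> \<gamma> > 0 \<and>
        S = {P x y z | x y z. x\<^sup>2 / \<alpha>\<^sup>2 + y\<^sup>2 / \<alpha>\<^sup>2 - z\<^sup>2 / \<gamma>\<^sup>2 = 1})"

end

theory Submission
  imports Defs
begin

text \<open>
  The structure \<open>q\<close> acts on \<open>T\<^sub>pM\<close> as a rotation of order three that permutes the
  orthonormal vectors \<open>u\<close>, \<open>qu\<close>, \<open>q\<^sup>2u\<close> cyclically. Its axis is the diagonal direction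
  \<open>u + qu + q\<^sup>2u\<close>, and the rotated system has its \<open>z'\<close>-axis there. Since
  \<open>f(v,v) = 2 g(v,qv)\<close>, the form \<open>f\<close> is invariant under this rotation, so it must be diagonal
  in the rotated system with equal coefficients along \<open>x'\<close> and \<open>y'\<close>: on the axis, where
  \<open>qv = v\<close>, it is \<open>2 g(v,v)\<close>, and on the orthogonal plane, where \<open>q\<close> turns by 120 degrees
  and \<open>cos 120\<degree> = - 1/2\<close>, it is \<open>- g(v,v)\<close>. Hence \<open>f(v,v) = - x'\<^sup>2 - y'\<^sup>2 + 2 z'\<^sup>2\<close>. The three
  cases are then the canonical equations, scaled so that the right-hand side is 0, -1 or 1.

  The analytic content is \<open>q\<^sup>3 = id\<close> (lemma \<open>circulant_structure_cubed\<close>). Invariance of \<open>g\<close>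
  alone only forces \<open>q\<^sup>3u = u\<close> or \<open>q\<^sup>3u = - u\<close>, since \<open>q\<^sup>3u\<close> is a unit vector orthogonal to
  \<open>qu\<close> and \<open>q\<^sup>2u\<close>; the sign comes from the component matrix. To compute with that matrix, a
  tangent vector has to be the combination of the coordinate vectors with its own components as
  coefficients, and the coordinate vectors have to be tangent vectors, which is the chain rule
  for transition maps.
\<close>

section \<open>Tangent vectors and their components in a chart\<close>

lemma chart_inv_coord:
  assumes "is_chart M c" "x \<in> dom_of c"
  shows "chart_inv c (coord_of c x) = x"
proof -
  have "dom_of c \<subseteq> topspace M"
    using assms(1) openin_subset unfolding is_chart_def by blast
  then have "inj_on (coord_of c) (dom_of c)"
    using assms(1) homeomorphic_imp_injective_map[of "subtopology M (dom_of c)"]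
    unfolding is_chart_def by (metis topspace_subtopology_subset)
  then show ?thesis
    using assms(2) by (simp add: chart_inv_def)
qed

lemma open_coord_image:
  assumes "is_chart M c" "openin M V"
  shows "open (coord_of c ` (dom_of c \<inter> V))"
proof -
  have "openin (subtopology M (dom_of c)) (dom_of c \<inter> V)"
    using assms(2) by (simp add: openin_subtopology_Int2)
  moreover have "open_map (subtopology M (dom_of c)) (top_of_set (coord_of c ` dom_of c)) (coord_of c)"
    using assms(1) homeomorphic_imp_open_map unfolding is_chart_def by blast
  ultimately have "openin (top_of_set (coord_of c ` dom_of c)) (coord_of c ` (dom_of c \<inter> V))"
    unfolding open_map_def by blast
  moreover have "open (coord_of c ` dom_of c)"
    using assms(1) unfolding is_chart_def by blast
  ultimately show ?thesis
    using openin_open_eq by blast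
qed

lemma transition_coord:
  assumes "is_chart M c" "x \<in> dom_of c"
  shows "transition c c' (coord_of c x) = coord_of c' x"
  using chart_inv_coord[OF assms] by (simp add: transition_def)

lemma transition_has_derivative:
  assumes "smooth_3_manifold M A" "c \<in> A" "c' \<in> A" "p \<in> dom_of c" "p \<in> dom_of c'"
  shows "(transition c c' has_derivative
           frechet_derivative (transition c c') (at (coord_of c p))) (at (coord_of c p))"
proof -
  let ?S = "coord_of c ` (dom_of c \<inter> dom_of c')"
  have charts: "is_chart M c" "is_chart M c'" and "compatible c c'"
    using assms unfolding smooth_3_manifold_def by blast+
  then have "C_on (Suc 0) ?S (transition c c')"
    unfolding compatible_def smooth_on_def by blast
  then have "transition c c' differentiable_on ?S"
    by simp
  moreover have "open ?S"
    using open_coord_image charts unfolding is_chart_def by blast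
  moreover have "coord_of c p \<in> ?S"
    using assms by blast
  ultimately have "transition c c' differentiable at (coord_of c p)"
    using differentiable_on_eq_differentiable_at by blast
  then show ?thesis
    using frechet_derivative_works by blast
qed

text \<open>
  The cocycle identity \<open>transition c c'' = transition c' c'' \<circ> transition c c'\<close> holds on the
  part of the domain of \<open>c\<close> that also lies in \<open>c'\<close>. This is an open set in coordinates, which
  is enough for the chain rule at a common point.
\<close>

lemma frechet_derivative_transition_cocycle:
  assumes M: "smooth_3_manifold M A"
    and c: "c \<in> A" "c' \<in> A" "c'' \<in> A" "p \<in> dom_of c" "p \<in> dom_of c'" "p \<in> dom_of c''"
  shows "frechet_derivative (transition c c'') (at (coord_of c p)) h =
         frechet_derivative (transition c' c'') (at (coord_of c' p))
           (frechet_derivative (transition c c') (at (coord_of c p)) h)"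
proof -
  let ?S = "coord_of c ` (dom_of c \<inter> dom_of c')"
  let ?D = "frechet_derivative (transition c c') (at (coord_of c p))"
  let ?D' = "frechet_derivative (transition c' c'') (at (coord_of c' p))"
  have charts: "is_chart M c" "is_chart M c'"
    using M c unfolding smooth_3_manifold_def by blast+
  have "(transition c' c'' has_derivative ?D') (at (transition c c' (coord_of c p)))"
    using transition_has_derivative[OF M c(2,3,5,6)] transition_coord charts(1) c(4) by metis
  then have comp: "((transition c' c'' \<circ> transition c c') has_derivative (?D' \<circ> ?D)) (at (coord_of c p))"
    using transition_has_derivative[OF M c(1,2,4,5)] by (intro diff_chain_at)
  have "open ?S" "coord_of c p \<in> ?S"
    using open_coord_image charts c unfolding is_chart_def by blast+
  moreover have "(transition c' c'' \<circ> transition c c') y = transition c c'' y" if "y \<in> ?S" for y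
    using that by (auto simp: transition_coord[OF charts(1)] transition_coord[OF charts(2)])
  ultimately have "(transition c c'' has_derivative (?D' \<circ> ?D)) (at (coord_of c p))"
    using has_derivative_transform_within_open[OF comp] by blast
  from fun_cong[OF frechet_derivative_at[OF this], of h] show ?thesis
    by simp
qed

lemma tangent_vector_transform:
  assumes "v \<in> tangent_space A p" "c \<in> A" "c' \<in> A" "p \<in> dom_of c" "p \<in> dom_of c'"
  shows "v c' = frechet_derivative (transition c c') (at (coord_of c p)) (v c)"
  using assms unfolding tangent_space_def by blast

lemma tangent_vector_outside:
  assumes "v \<in> tangent_space A p" "\<not> (c \<in> A \<and> p \<in> dom_of c)"
  shows "v c = 0"
  using assms unfolding tangent_space_def by blast

lemma tangent_spaceI:
  assumes "\<And>c c'. c \<in> A \<Longrightarrow> c' \<in> A \<Longrightarrow> p \<in> dom_of c \<Longrightarrow> p \<in> dom_of c' \<Longrightarrow>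
      v c' = frechet_derivative (transition c c') (at (coord_of c p)) (v c)"
    and "\<And>c. \<not> (c \<in> A \<and> p \<in> dom_of c) \<Longrightarrow> v c = 0"
  shows "v \<in> tangent_space A p"
  using assms unfolding tangent_space_def by blast

lemma coord_vector_in_tangent_space:
  assumes "smooth_3_manifold M A" "c \<in> A" "p \<in> dom_of c"
  shows "coord_vector A c p i \<in> tangent_space A p"
proof (rule tangent_spaceI)
  fix c' c'' assume "c' \<in> A" "c'' \<in> A" "p \<in> dom_of c'" "p \<in> dom_of c''"
  then show "coord_vector A c p i c'' =
      frechet_derivative (transition c' c'') (at (coord_of c' p)) (coord_vector A c p i c')"
    using frechet_derivative_transition_cocycle assms by (simp add: coord_vector_def)
next
  fix c' assume "\<not> (c' \<in> A \<and> p \<in> dom_of c')"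
  then show "coord_vector A c p i c' = 0"
    unfolding coord_vector_def by (rule if_not_P)
qed

lemma linear_frechet_derivative_transition:
  assumes "smooth_3_manifold M A" "c \<in> A" "c' \<in> A" "p \<in> dom_of c" "p \<in> dom_of c'"
  shows "linear (frechet_derivative (transition c c') (at (coord_of c p)))"
  using transition_has_derivative[OF assms] has_derivative_linear by blast

lemma subspace_tangent_space:
  assumes M: "smooth_3_manifold M A"
  shows "subspace (tangent_space A p)"
  unfolding subspace_def
proof (intro conjI ballI allI)
  note linear = linear_frechet_derivative_transition[OF M]
  note transform = tangent_vector_transform and outside = tangent_vector_outside
  show "0 \<in> tangent_space A p"
    by (rule tangent_spaceI) (simp_all add: linear_0[OF linear])
  show "v + w \<in> tangent_space A p" if v: "v \<in> tangent_space A p" and w: "w \<in> tangent_space A p"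
    for v w
  proof (rule tangent_spaceI)
    fix c c' assume c: "c \<in> A" "c' \<in> A" "p \<in> dom_of c" "p \<in> dom_of c'"
    show "(v + w) c' = frechet_derivative (transition c c') (at (coord_of c p)) ((v + w) c)"
      using linear_add[OF linear[OF c], of "v c" "w c"] transform[OF v c] transform[OF w c]
      by (simp only: plus_fun_apply)
  next
    fix c assume "\<not> (c \<in> A \<and> p \<in> dom_of c)"
    then have "v c = 0" "w c = 0"
      using outside[OF v] outside[OF w] by blast+
    then show "(v + w) c = 0"
      by simp
  qed
  show "a *\<^sub>R v \<in> tangent_space A p" if v: "v \<in> tangent_space A p" for a v
  proof (rule tangent_spaceI)
    fix c c' assume c: "c \<in> A" "c' \<in> A" "p \<in> dom_of c" "p \<in> dom_of c'"
    show "(a *\<^sub>R v) c' = frechet_derivative (transition c c') (at (coord_of c p)) ((a *\<^sub>R v) c)"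
      using linear_cmul[OF linear[OF c], of a "v c"] transform[OF v c]
      by (simp only: scaleR_fun_def)
  next
    fix c assume "\<not> (c \<in> A \<and> p \<in> dom_of c)"
    then have "v c = 0"
      using outside[OF v] by blast
    then show "(a *\<^sub>R v) c = 0"
      by (simp add: scaleR_fun_def)
  qed
qed

lemma tangent_vector_eqI:
  assumes "v \<in> tangent_space A p" "w \<in> tangent_space A p"
    and "c \<in> A" "p \<in> dom_of c" "v c = w c"
  shows "v = w"
proof
  fix c'
  show "v c' = w c'"
  proof (cases "c' \<in> A \<and> p \<in> dom_of c'")
    case True
    then show ?thesis
      using tangent_vector_transform[of _ A p c c'] assms by metis
  next
    case False
    then show ?thesis
      using tangent_vector_outside assms(1,2) by metis
  qed
qed

lemma tangent_vector_coord_expansion: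
  assumes M: "smooth_3_manifold M A" and c: "c \<in> A" "p \<in> dom_of c"
    and v: "v \<in> tangent_space A p"
  shows "v = (\<Sum>i\<in>UNIV. (v c $ i) *\<^sub>R coord_vector A c p i)"
proof
  fix c'
  have expand: "(\<Sum>i\<in>UNIV. (v c $ i) *\<^sub>R coord_vector A c p i) c' =
      (\<Sum>i\<in>UNIV. (v c $ i) *\<^sub>R coord_vector A c p i c')"
    by (simp add: sum_3 scaleR_fun_def)
  show "v c' = (\<Sum>i\<in>UNIV. (v c $ i) *\<^sub>R coord_vector A c p i) c'"
  proof (cases "c' \<in> A \<and> p \<in> dom_of c'")
    case True
    let ?D = "frechet_derivative (transition c c') (at (coord_of c p))"
    have D: "linear ?D"
      using True by (intro linear_frechet_derivative_transition[OF M c(1) _ c(2)]) simp_all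
    have expansion: "(\<Sum>i\<in>UNIV. (v c $ i) *\<^sub>R axis i 1) = v c"
      using basis_expansion[of "v c"] unfolding scalar_mult_eq_scaleR .
    have "v c' = ?D (\<Sum>i\<in>UNIV. (v c $ i) *\<^sub>R axis i 1)"
      unfolding expansion using True by (intro tangent_vector_transform[OF v c(1) _ c(2)]) simp_all
    also have "\<dots> = (\<Sum>i\<in>UNIV. (v c $ i) *\<^sub>R ?D (axis i 1))"
      by (simp add: linear_sum[OF D] linear_cmul[OF D])
    finally show ?thesis
      unfolding expand using True by (simp add: coord_vector_def)
  next
    case False
    then have "v c' = 0"
      using tangent_vector_outside[OF v] by blast
    then show ?thesis
      unfolding expand using False by (auto simp: coord_vector_def)
  qed
qed

lemma linear_on_sum3:
  assumes "linear_on T F" "subspace T" "e1 \<in> T" "e2 \<in> T" "e3 \<in> T"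
  shows "F (x *\<^sub>R e1 + y *\<^sub>R e2 + z *\<^sub>R e3) = x *\<^sub>R F e1 + y *\<^sub>R F e2 + z *\<^sub>R F e3"
proof -
  have "x *\<^sub>R e1 + y *\<^sub>R e2 \<in> T"
    using assms by (simp add: subspace_add subspace_scale)
  then have "F (1 *\<^sub>R (x *\<^sub>R e1 + y *\<^sub>R e2) + z *\<^sub>R e3) =
      1 *\<^sub>R F (x *\<^sub>R e1 + y *\<^sub>R e2) + z *\<^sub>R F e3"
    using assms(1,5) unfolding linear_on_def by blast
  moreover have "F (x *\<^sub>R e1 + y *\<^sub>R e2) = x *\<^sub>R F e1 + y *\<^sub>R F e2"
    using assms unfolding linear_on_def by blast
  ultimately show ?thesis
    by simp
qed

text \<open>
  Linearity of \<open>q\<close> is available on the tangent space only, so the expansion in coordinate vectors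
  can be used because these are tangent vectors themselves.
\<close>

lemma tensor11_apply:
  assumes M: "smooth_3_manifold M A" and q: "tensor11_field M A q"
    and c: "c \<in> A" "p \<in> dom_of c" and v: "v \<in> tangent_space A p"
  shows "q p v c = tensor11_components A q c p *v v c"
proof -
  let ?e = "coord_vector A c p"
  have "p \<in> topspace M"
    using M c unfolding smooth_3_manifold_def by blast
  then have lin: "linear_on (tangent_space A p) (q p)"
    using q unfolding tensor11_field_def by blast
  have "v = (v c $ 1) *\<^sub>R ?e 1 + (v c $ 2) *\<^sub>R ?e 2 + (v c $ 3) *\<^sub>R ?e 3"
    using tangent_vector_coord_expansion[OF M c v] by (simp add: sum_3)
  then have "q p v =
      (v c $ 1) *\<^sub>R q p (?e 1) + (v c $ 2) *\<^sub>R q p (?e 2) + (v c $ 3) *\<^sub>R q p (?e 3)"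
    using linear_on_sum3[OF lin subspace_tangent_space[OF M]]
      coord_vector_in_tangent_space[OF M c] by metis
  then show ?thesis
    by (simp add: vec_eq_iff matrix_vector_mult_def sum_3 tensor11_components_def
        scaleR_fun_def mult.commute)
qed

text \<open>The circulant matrix is a permutation matrix of order three.\<close>

lemma circulant_structure_cubed:
  assumes M: "smooth_3_manifold M A" and circ: "circulant_structure M A q"
    and p: "p \<in> topspace M" and v: "v \<in> tangent_space A p"
  shows "q p (q p (q p v)) = v"
proof -
  obtain c where c: "c \<in> A" "p \<in> dom_of c"
    and comp: "tensor11_components A q c p = circulant_matrix"
    using circ p unfolding circulant_structure_def by blast
  have field: "tensor11_field M A q"
    using circ unfolding circulant_structure_def by blast
  have closed: "q p w \<in> tangent_space A p" if "w \<in> tangent_space A p" for w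
    using field p that unfolding tensor11_field_def by blast
  have q_c: "q p w c = circulant_matrix *v w c" if "w \<in> tangent_space A p" for w
    using tensor11_apply[OF M field c that] comp by simp
  have "q p (q p (q p v)) c = v c"
    using v by (simp add: q_c closed circulant_matrix_def vec_eq_iff forall_3
        matrix_vector_mult_def sum_3)
  then show ?thesis
    using tangent_vector_eqI closed v c by metis
qed

section \<open>Orthonormal bases of a three-dimensional inner product space\<close>

lemma span_3: "span {e1, e2, e3} = {x *\<^sub>R e1 + y *\<^sub>R e2 + z *\<^sub>R e3 | x y z. True}"
proof -
  have "v \<in> span {e1, e2, e3} \<longleftrightarrow> (\<exists>x y z. v = x *\<^sub>R e1 + y *\<^sub>R e2 + z *\<^sub>R e3)" for v
    unfolding span_breakdown_eq span_empty
    by (auto simp: algebra_simps)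
  then show ?thesis
    by auto
qed

lemma is_basis3D:
  assumes "is_basis3 T e1 e2 e3"
  shows "subspace T" "e1 \<in> T" "e2 \<in> T" "e3 \<in> T"
  using assms unfolding is_basis3_def by (auto intro: span_base)

lemma orthonormal3_form:
  assumes "subspace T" "e1 \<in> T" "e2 \<in> T" "e3 \<in> T"
    and lin: "\<forall>v\<in>T. linear_on T (G v)"
    and sym: "\<forall>v\<in>T. \<forall>w\<in>T. G v w = G w v"
    and on: "orthonormal3 G e1 e2 e3"
  shows "G (x *\<^sub>R e1 + y *\<^sub>R e2 + z *\<^sub>R e3) (x' *\<^sub>R e1 + y' *\<^sub>R e2 + z' *\<^sub>R e3) =
         x * x' + y * y' + z * z'"
proof -
  note sum3 = linear_on_sum3[OF bspec[OF lin] assms(1-4)]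
  let ?v = "x *\<^sub>R e1 + y *\<^sub>R e2 + z *\<^sub>R e3"
  have v: "?v \<in> T"
    using assms(1-4) by (simp add: subspace_add subspace_scale)
  have products: "G e1 e1 = 1" "G e2 e2 = 1" "G e3 e3 = 1"
    "G e1 e2 = 0" "G e1 e3 = 0" "G e2 e3 = 0" "G e2 e1 = 0" "G e3 e1 = 0" "G e3 e2 = 0"
    using on sym assms(2-4) unfolding orthonormal3_def by auto
  have "G e1 ?v = x" "G e2 ?v = y" "G e3 ?v = z"
    using assms(2-4) by (simp_all add: sum3 products)
  then have "G ?v e1 = x" "G ?v e2 = y" "G ?v e3 = z"
    using sym v assms(2-4) by metis+
  then show ?thesis
    using v by (simp add: sum3 mult.commute)
qed

lemma orthonormal3_independent:
  assumes "subspace T" "e1 \<in> T" "e2 \<in> T" "e3 \<in> T"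
    and lin: "\<forall>v\<in>T. linear_on T (G v)"
    and sym: "\<forall>v\<in>T. \<forall>w\<in>T. G v w = G w v"
    and on: "orthonormal3 G e1 e2 e3"
  shows "distinct [e1, e2, e3] \<and> independent {e1, e2, e3}"
proof -
  note form = orthonormal3_form[OF assms]
  have coeffs: "x = x' \<and> y = y' \<and> z = z'"
    if "x *\<^sub>R e1 + y *\<^sub>R e2 + z *\<^sub>R e3 = x' *\<^sub>R e1 + y' *\<^sub>R e2 + z' *\<^sub>R e3" for x y z x' y' z'
    using form[of x y z 1 0 0] form[of x' y' z' 1 0 0] form[of x y z 0 1 0]
      form[of x' y' z' 0 1 0] form[of x y z 0 0 1] form[of x' y' z' 0 0 1]
    unfolding that by simp
  have dist: "distinct [e1, e2, e3]"
    using on unfolding orthonormal3_def by auto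
  have "e1 \<noteq> k *\<^sub>R e2 + l *\<^sub>R e3" "e2 \<noteq> l *\<^sub>R e3" "e3 \<noteq> 0" for k l
    using coeffs[of 1 0 0 0 k l] coeffs[of 0 1 0 0 0 l] coeffs[of 0 0 1 0 0 0] by auto
  then have "e1 \<notin> span {e2, e3}" "e2 \<notin> span {e3}" "e3 \<noteq> 0"
    by (auto simp: span_breakdown_eq algebra_simps)
  then show ?thesis
    using dist by (simp add: independent_insert)
qed

text \<open>
  Orthonormality of the images is a polynomial identity in the matrix entries. That they span
  follows by writing the old basis in the new one with the transposed matrix. The summand with
  coefficient 0 keeps all three vectors in the shape of \<open>orthonormal3_form\<close>.
\<close>

lemma rotated_orthonormal_basis:
  assumes basis: "is_basis3 T e1 e2 e3" and on: "orthonormal3 G e1 e2 e3"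
    and lin: "\<forall>v\<in>T. linear_on T (G v)"
    and sym: "\<forall>v\<in>T. \<forall>w\<in>T. G v w = G w v"
  defines "d1 \<equiv> (1 / sqrt 2) *\<^sub>R e1 + 0 *\<^sub>R e2 + (- (1 / sqrt 2)) *\<^sub>R e3"
    and "d2 \<equiv> (- (1 / sqrt 6)) *\<^sub>R e1 + (sqrt 2 / sqrt 3) *\<^sub>R e2 + (- (1 / sqrt 6)) *\<^sub>R e3"
    and "d3 \<equiv> (1 / sqrt 3) *\<^sub>R e1 + (1 / sqrt 3) *\<^sub>R e2 + (1 / sqrt 3) *\<^sub>R e3"
  shows "is_basis3 T d1 d2 d3 \<and> orthonormal3 G d1 d2 d3"
proof -
  note T = is_basis3D[OF basis]
  note form = orthonormal3_form[OF T lin sym on]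
  have sqrt6: "sqrt 6 = sqrt 2 * sqrt 3"
    by (simp flip: real_sqrt_mult)
  have sqrt6_square: "sqrt 2 * sqrt 3 * (sqrt 2 * sqrt 3) = (6 :: real)"
    by (simp flip: sqrt6)
  have d: "d1 \<in> T" "d2 \<in> T" "d3 \<in> T"
    unfolding d1_def d2_def d3_def
    using T by (simp_all add: subspace_add subspace_diff subspace_neg subspace_scale)
  have on': "orthonormal3 G d1 d2 d3"
    unfolding orthonormal3_def d1_def d2_def d3_def form by (auto simp: sqrt6 field_simps)
  have combination: "x *\<^sub>R d1 + y *\<^sub>R d2 + z *\<^sub>R d3 =
      (x / sqrt 2 - y / sqrt 6 + z / sqrt 3) *\<^sub>R e1 + (y * (sqrt 2 / sqrt 3) + z / sqrt 3) *\<^sub>R e2 +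
      (- x / sqrt 2 - y / sqrt 6 + z / sqrt 3) *\<^sub>R e3" for x y z
    by (simp add: d1_def d2_def d3_def algebra_simps)
  have "e1 = (1 / sqrt 2) *\<^sub>R d1 + (- (1 / sqrt 6)) *\<^sub>R d2 + (1 / sqrt 3) *\<^sub>R d3"
    "e2 = 0 *\<^sub>R d1 + (sqrt 2 / sqrt 3) *\<^sub>R d2 + (1 / sqrt 3) *\<^sub>R d3"
    "e3 = (- (1 / sqrt 2)) *\<^sub>R d1 + (- (1 / sqrt 6)) *\<^sub>R d2 + (1 / sqrt 3) *\<^sub>R d3"
    unfolding combination by (simp_all add: sqrt6 sqrt6_square)
  then have "{e1, e2, e3} \<subseteq> span {d1, d2, d3}"
    unfolding span_3 by blast
  then have "T \<subseteq> span {d1, d2, d3}"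
    using basis span_minimal[OF _ subspace_span] unfolding is_basis3_def by blast
  moreover have "span {d1, d2, d3} \<subseteq> T"
    using d T(1) by (simp add: span_minimal)
  ultimately show ?thesis
    using orthonormal3_independent[OF T(1) d lin sym on'] on' unfolding is_basis3_def by blast
qed

section \<open>The spheres of the associated metric\<close>

theorem theorem4p1:
  fixes M :: "'m topology" and A :: "'m chart set"
    and g :: "'m \<Rightarrow> 'm tvec \<Rightarrow> 'm tvec \<Rightarrow> real"
    and q :: "'m \<Rightarrow> 'm tvec \<Rightarrow> 'm tvec"
    and p :: 'm and u :: "'m tvec"
    and P P' :: "real \<Rightarrow> real \<Rightarrow> real \<Rightarrow> 'm tvec"
    and r2 :: real and s :: "'m tvec set"
  assumes "circulant_riemannian_manifold M A g q"
    and "p \<in> topspace M"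
    and "is_basis3 (tangent_space A p) u (q p u) (q p (q p u))"
    and "orthonormal3 (g p) u (q p u) (q p (q p u))"
    and "\<And>x y z. P x y z = x *\<^sub>R u + y *\<^sub>R q p u + z *\<^sub>R q p (q p u)"
    and "\<And>x' y' z'. P' x' y' z' =
           P (1 / sqrt 2 * x' - 1 / sqrt 6 * y' + 1 / sqrt 3 * z')
             (sqrt 2 / sqrt 3 * y' + 1 / sqrt 3 * z')
             (- (1 / sqrt 2) * x' - 1 / sqrt 6 * y' + 1 / sqrt 3 * z')"
    and "s = f_sphere A g q p r2"
  shows "cartesian_system (tangent_space A p) (g p) P' \<and>
    (\<forall>x' y' z'. P' x' y' z' \<in> s \<longleftrightarrow> x'\<^sup>2 + y'\<^sup>2 - 2 * z'\<^sup>2 = - r2) \<and>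
    (r2 = 0 \<longrightarrow>
       circular_double_cone (tangent_space A p) (g p) s \<and>
       s = {P' x' y' z' | x' y' z'. x'\<^sup>2 + y'\<^sup>2 - 2 * z'\<^sup>2 = 0}) \<and>
    (r2 > 0 \<longrightarrow>
       circular_hyperboloid_two_sheets (tangent_space A p) (g p) s \<and>
       (\<exists>a::real. a > 0 \<and> a\<^sup>2 = r2 \<and>
          s = {P' x' y' z' | x' y' z'. x'\<^sup>2 + y'\<^sup>2 - 2 * z'\<^sup>2 = - a\<^sup>2})) \<and>
    (r2 < 0 \<longrightarrow>
       circular_hyperboloid_one_sheet (tangent_space A p) (g p) s \<and>
       (\<exists>a::real. a > 0 \<and> a\<^sup>2 = - r2 \<and>
          s = {P' x' y' z' | x' y' z'. x'\<^sup>2 + y'\<^sup>2 - 2 * z'\<^sup>2 = a\<^sup>2}))"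
proof -
  let ?T = "tangent_space A p" and ?G = "g p"
  let ?e1 = u and ?e2 = "q p u" and ?e3 = "q p (q p u)"
  note basis = assms(3) and on = assms(4)
  note T = is_basis3D[OF basis]
  have M: "smooth_3_manifold M A" and circ: "circulant_structure M A q"
    using assms(1) unfolding circulant_riemannian_manifold_def by blast+
  have lin: "\<forall>v\<in>?T. linear_on ?T (?G v)"
    using assms(1,2) unfolding circulant_riemannian_manifold_def riemannian_metric_def by blast
  have sym: "\<forall>v\<in>?T. \<forall>w\<in>?T. ?G v w = ?G w v"
    using assms(1,2) unfolding circulant_riemannian_manifold_def riemannian_metric_def by blast
  have q_lin: "linear_on ?T (q p)"
    using circ assms(2) unfolding circulant_structure_def tensor11_field_def by blast
  note form = orthonormal3_form[OF T lin sym on]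

  have P_in: "P x y z \<in> ?T" for x y z
    unfolding assms(5) using T by (simp add: subspace_add subspace_scale)
  have T_eq: "?T = {P x y z | x y z. True}"
    using basis unfolding is_basis3_def span_3 assms(5) by simp
  have q_P: "q p (P x y z) = P z x y" for x y z
    unfolding assms(5) linear_on_sum3[OF q_lin T]
    using circulant_structure_cubed[OF M circ assms(2) T(2)] by (simp add: algebra_simps)
  have f_P: "associated_metric g q p (P x y z) (P x y z) = 2 * (x * y + y * z + z * x)" for x y z
    unfolding associated_metric_def q_P unfolding assms(5) form by (simp add: algebra_simps)

  have P'_in: "P' x y z \<in> ?T" for x y z
    unfolding assms(6) by (rule P_in)

  define d1 d2 d3 where
    "d1 = (1 / sqrt 2) *\<^sub>R ?e1 + 0 *\<^sub>R ?e2 + (- (1 / sqrt 2)) *\<^sub>R ?e3" and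
    "d2 = (- (1 / sqrt 6)) *\<^sub>R ?e1 + (sqrt 2 / sqrt 3) *\<^sub>R ?e2 + (- (1 / sqrt 6)) *\<^sub>R ?e3" and
    "d3 = (1 / sqrt 3) *\<^sub>R ?e1 + (1 / sqrt 3) *\<^sub>R ?e2 + (1 / sqrt 3) *\<^sub>R ?e3"
  have rotated: "is_basis3 ?T d1 d2 d3" "orthonormal3 ?G d1 d2 d3"
    using rotated_orthonormal_basis[OF basis on lin sym] unfolding d1_def d2_def d3_def by blast+
  have P'_eq: "P' x y z = x *\<^sub>R d1 + y *\<^sub>R d2 + z *\<^sub>R d3" for x y z
    unfolding assms(5,6) d1_def d2_def d3_def
    by (simp add: algebra_simps)
  have cart: "cartesian_system ?T ?G P'"
    unfolding cartesian_system_def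
    using rotated P'_eq subspace_0[OF T(1)]
    by (intro exI[of _ 0] exI[of _ d1] exI[of _ d2] exI[of _ d3]) (auto simp: fun_eq_iff)
  have T_eq': "?T = {P' x y z | x y z. True}"
    using rotated(1) unfolding is_basis3_def span_3 P'_eq by simp

  \<comment> \<open>The form \<open>2 (xy + yz + zx) = (x + y + z)\<^sup>2 - (x\<^sup>2 + y\<^sup>2 + z\<^sup>2)\<close> in the rotated coordinates:
    the sum of squares is preserved, and \<open>x + y + z\<close> becomes \<open>\<surd>3\<close> times the coordinate
    along the axis.\<close>
  have f_P': "associated_metric g q p (P' x y z) (P' x y z) = 2 * z\<^sup>2 - x\<^sup>2 - y\<^sup>2" for x y z
  proof -
    define X Y Z where "X = 1 / sqrt 2 * x - 1 / sqrt 6 * y + 1 / sqrt 3 * z"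
      and "Y = sqrt 2 / sqrt 3 * y + 1 / sqrt 3 * z"
      and "Z = - (1 / sqrt 2) * x - 1 / sqrt 6 * y + 1 / sqrt 3 * z"
    have P'_P: "P' x y z = P X Y Z"
      by (simp add: assms(6) X_def Y_def Z_def)
    have "X\<^sup>2 + Y\<^sup>2 + Z\<^sup>2 = ?G (P' x y z) (P' x y z)"
      unfolding P'_P assms(5) form by (simp add: power2_eq_square)
    also have "\<dots> = x\<^sup>2 + y\<^sup>2 + z\<^sup>2"
      unfolding P'_eq orthonormal3_form[OF is_basis3D[OF rotated(1)] lin sym rotated(2)]
      by (simp add: power2_eq_square)
    finally have squares: "X\<^sup>2 + Y\<^sup>2 + Z\<^sup>2 = x\<^sup>2 + y\<^sup>2 + z\<^sup>2" .
    have "sqrt 6 = sqrt 2 * sqrt 3"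
      by (simp flip: real_sqrt_mult)
    then have "X + Y + Z = sqrt 3 * z"
      unfolding X_def Y_def Z_def by (simp add: field_simps)
    then have "(X + Y + Z)\<^sup>2 = 3 * z\<^sup>2"
      by (simp add: power_mult_distrib)
    then show ?thesis
      unfolding P'_P f_P using squares by (simp add: power2_eq_square algebra_simps)
  qed

  have equation: "P' x y z \<in> s \<longleftrightarrow> x\<^sup>2 + y\<^sup>2 - 2 * z\<^sup>2 = - r2" for x y z
    unfolding assms(7) f_sphere_def using P'_in f_P' by auto
  have s_eq: "s = {P' x y z | x y z. x\<^sup>2 + y\<^sup>2 - 2 * z\<^sup>2 = - r2}"
  proof -
    have "s \<subseteq> {P' x y z | x y z. True}"
      unfolding assms(7) f_sphere_def T_eq'[symmetric] by blast
    then show ?thesis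
      using equation by blast
  qed

  have cone: "circular_double_cone ?T ?G s" if "r2 = 0"
  proof -
    have "x\<^sup>2 / 1\<^sup>2 + y\<^sup>2 / 1\<^sup>2 - z\<^sup>2 / (1 / sqrt 2)\<^sup>2 = x\<^sup>2 + y\<^sup>2 - 2 * z\<^sup>2" for x y z :: real
      by (simp add: power_divide)
    then have "s = {P' x y z | x y z. x\<^sup>2 / 1\<^sup>2 + y\<^sup>2 / 1\<^sup>2 - z\<^sup>2 / (1 / sqrt 2)\<^sup>2 = 0}"
      using s_eq that by simp
    moreover have "(1::real) > 0" "1 / sqrt 2 > 0"
      by simp_all
    ultimately show ?thesis
      unfolding circular_double_cone_def using cart by blast
  qed
  \<comment> \<open>Dividing the equation by \<open>a\<^sup>2 = \<bar>r2\<bar>\<close> gives semi-axes \<open>a\<close>, \<open>a\<close> and \<open>a / \<surd>2\<close>.\<close>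
  have scale: "x\<^sup>2 / a\<^sup>2 + y\<^sup>2 / a\<^sup>2 - z\<^sup>2 / (a / sqrt 2)\<^sup>2 = (x\<^sup>2 + y\<^sup>2 - 2 * z\<^sup>2) / a\<^sup>2"
    for a x y z :: real
    by (simp add: power_divide add_divide_distrib diff_divide_distrib)
  have two: "circular_hyperboloid_two_sheets ?T ?G s" if "r2 > 0"
  proof -
    have "s = {P' x y z | x y z.
        x\<^sup>2 / (sqrt r2)\<^sup>2 + y\<^sup>2 / (sqrt r2)\<^sup>2 - z\<^sup>2 / (sqrt r2 / sqrt 2)\<^sup>2 = -1}"
      unfolding s_eq scale using that by (simp add: divide_eq_eq)
    moreover have "sqrt r2 > 0" "sqrt r2 / sqrt 2 > 0"
      using that by simp_all
    ultimately show ?thesis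
      unfolding circular_hyperboloid_two_sheets_def using cart by blast
  qed
  have one: "circular_hyperboloid_one_sheet ?T ?G s" if "r2 < 0"
  proof -
    have "s = {P' x y z | x y z.
        x\<^sup>2 / (sqrt (- r2))\<^sup>2 + y\<^sup>2 / (sqrt (- r2))\<^sup>2 - z\<^sup>2 / (sqrt (- r2) / sqrt 2)\<^sup>2 = 1}"
      unfolding s_eq scale using that by (simp add: divide_eq_eq)
    moreover have "sqrt (- r2) > 0" "sqrt (- r2) / sqrt 2 > 0"
      using that by simp_all
    ultimately show ?thesis
      unfolding circular_hyperboloid_one_sheet_def using cart by blast
  qed

  have "\<exists>a::real. a > 0 \<and> a\<^sup>2 = r2 \<and> s = {P' x y z | x y z. x\<^sup>2 + y\<^sup>2 - 2 * z\<^sup>2 = - a\<^sup>2}"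
    if "r2 > 0"
    using that s_eq by (intro exI[of _ "sqrt r2"]) simp
  moreover have "\<exists>a::real. a > 0 \<and> a\<^sup>2 = - r2 \<and> s = {P' x y z | x y z. x\<^sup>2 + y\<^sup>2 - 2 * z\<^sup>2 = a\<^sup>2}"
    if "r2 < 0"
    using that s_eq by (intro exI[of _ "sqrt (- r2)"]) simp
  moreover have "s = {P' x y z | x y z. x\<^sup>2 + y\<^sup>2 - 2 * z\<^sup>2 = 0}" if "r2 = 0"
    using that s_eq by simp
  ultimately show ?thesis
    using cart equation cone two one by blast
qed

end
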